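(* Let $\{f_n\}_{n\ge1}$ and $f$ be probability density functions on $\mathbb{R}^d$ such that $f_n\to f$ in Lebesgue measure and $H(f)$ is finite. If $\sup_n\int_{\mathbb{R}^d} f_n\,(\lvert\log f_n\rvert)^\alpha\,dx<\infty$ for some fixed $\alpha>1$, then $H(f_n)\to H(f)$.
   Context: A probability density function (pdf) on $\mathbb{R}^d$ is a measurable $f:\mathbb{R}^d\to[0,\infty)$ with $\int f\,dx=1$. The differential entropy is $H(f)=-\int_{\mathbb{R}^d} f\log f\,dx$, with natural logarithm and the convention $0\log0=0$ (likewise $f\lvert\log f\rvert^{\alpha}=0$ where $f=0$). "$H(f)$ finite" means $f\log f\in L^1(\mathbb{R}^d)$. *)

theory Defs
  imports "HOL-Analysis.Analysis"
begin

definition is_pdf :: "('a::euclidean_space \<Rightarrow> real) \<Rightarrow> bool" where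
  "is_pdf f \<longleftrightarrow> f \<in> borel_measurable lebesgue \<and> (\<forall>x. 0 \<le> f x) \<and>
     (\<integral>\<^sup>+x. ennreal (f x) \<partial>lebesgue) = 1"

(* The convention 0 log 0 = 0 holds through the factor f x.  The integral is a Bochner integral,
   hence 0 by default when f log f is not integrable; the value is meaningful only under
   finite_diff_entropy. *)
definition diff_entropy :: "('a::euclidean_space \<Rightarrow> real) \<Rightarrow> real" where
  "diff_entropy f = - (\<integral>x. f x * ln (f x) \<partial>lebesgue)"

definition finite_diff_entropy :: "('a::euclidean_space \<Rightarrow> real) \<Rightarrow> bool" where
  "finite_diff_entropy f \<longleftrightarrow> integrable lebesgue (\<lambda>x. f x * ln (f x))"

(* Convergence in measure on the whole space (not merely on sets of finite measure).  The extended
   measure is used because the real-valued one is 0 on sets of infinite measure. *)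
definition tendsto_in_measure ::
  "'a measure \<Rightarrow> (nat \<Rightarrow> 'a \<Rightarrow> real) \<Rightarrow> ('a \<Rightarrow> real) \<Rightarrow> bool" where
  "tendsto_in_measure M F f \<longleftrightarrow>
     (\<forall>\<epsilon>>0. (\<lambda>n. emeasure M {x \<in> space M. \<epsilon> \<le> \<bar>F n x - f x\<bar>}) \<longlonglongrightarrow> 0)"

end

theory Submission
  imports Defs
begin

text \<open>For densities, convergence in measure implies convergence in \<open>L\<^sup>1\<close> (Scheffe).  Cutting the
  logarithm off at levels \<open>\<plusminus>M\<close> makes \<open>t ln t\<close> Lipschitz in \<open>t\<close> with constant \<open>M + 1\<close>, so the truncated
  entropies converge; by the moment bound \<open>C\<close> the truncation changes the entropy of \<open>F n\<close> by at most
  \<open>C M\<^sup>1\<^sup>-\<^sup>\<alpha>\<close>, uniformly in \<open>n\<close>.\<close>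

section \<open>From convergence in measure to convergence in mean\<close>

text \<open>Equal integrals reduce the L1 distance to twice the integral of the positive part of
  \<open>f - g n\<close>. That part never exceeds \<open>f\<close>, so the mass of
  \<open>g n\<close> needs no control. A direct estimate replaces the usual passage to almost
  everywhere convergent subsequences.\<close>

lemma tendsto_in_measure_imp_L1:
  fixes g :: "nat \<Rightarrow> 'a \<Rightarrow> real" and f :: "'a \<Rightarrow> real"
  assumes g: "\<And>n. integrable M (g n)" "\<And>n x. 0 \<le> g n x"
    and f: "integrable M f" "\<And>x. 0 \<le> f x"
    and eq: "\<And>n. (\<integral>x. g n x \<partial>M) = (\<integral>x. f x \<partial>M)"
    and lim: "tendsto_in_measure M g f"
  shows "(\<lambda>n. \<integral>x. \<bar>g n x - f x\<bar> \<partial>M) \<longlonglongrightarrow> 0"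
proof (rule LIMSEQ_I)
  fix e :: real assume e: "0 < e"
  \<comment> \<open>Off the set where \<open>g n\<close> and \<open>f\<close> differ by at least
    \<open>1 / real k\<close>, the positive part of \<open>f - g n\<close> is at most the first
    summand; the minimum with \<open>f x\<close> keeps this integrable on a space of infinite
    measure. On that set it is at most \<open>f x\<close>, hence at most the second summand plus
    \<open>real k\<close>. Thus \<open>q k\<close> does not depend on \<open>n\<close>, and the rest
    is \<open>real k\<close> times the measure of a set that shrinks with \<open>n\<close>.\<close>
  define q where "q k x = min (f x) (1 / real k) + max 0 (f x - real k)" for k x
  have [measurable]: "f \<in> borel_measurable M" "g n \<in> borel_measurable M" for n
    using f g by auto
  have q_bounds: "0 \<le> q k x" "q k x \<le> 2 * f x" for k x
    using f(2)[of x] by (auto simp: q_def min_def max_def intro: add_nonneg_nonneg)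
  have q_int: "integrable M (q k)" for k
  proof (rule Bochner_Integration.integrable_bound)
    show "integrable M (\<lambda>x. 2 * f x)"
      using f(1) by simp
    show "AE x in M. norm (q k x) \<le> norm (2 * f x)"
      using q_bounds f(2) by (auto intro!: AE_I2)
  qed (simp add: q_def[abs_def])
  have q_ptwise: "(\<lambda>k. q k x) \<longlonglongrightarrow> 0" for x
  proof -
    have "(\<lambda>k. min (f x) (1 / real k)) \<longlonglongrightarrow> min (f x) 0"
      by (intro tendsto_intros lim_1_over_n)
    moreover have "eventually (\<lambda>k. f x \<le> real k) sequentially"
      using filterlim_real_sequentially unfolding filterlim_at_top by blast
    then have "(\<lambda>k. max 0 (f x - real k)) \<longlonglongrightarrow> 0"
      by (intro tendsto_eventually) (auto elim!: eventually_mono)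
    ultimately show ?thesis
      unfolding q_def using tendsto_add[of _ "min (f x) 0" _ _ 0] f(2)[of x] by (simp add: min_absorb2)
  qed
  have "(\<lambda>k. \<integral>x. q k x \<partial>M) \<longlonglongrightarrow> (\<integral>x. 0 \<partial>M)"
  proof (rule integral_dominated_convergence[where w = "\<lambda>x. 2 * f x"])
    show "AE x in M. (\<lambda>k. q k x) \<longlonglongrightarrow> 0"
      using q_ptwise by simp
    show "AE x in M. norm (q k x) \<le> 2 * f x" for k
      using q_bounds by (auto intro!: AE_I2)
  qed (use f(1) q_int in auto)
  then have "eventually (\<lambda>k. (\<integral>x. q k x \<partial>M) < e / 4) sequentially"
    using e by (intro order_tendstoD(2)[of _ 0]) auto
  \<comment> \<open>Convergence in measure applies only to a positive threshold, and
    \<open>1 / real k\<close> is 0 at \<open>k = 0\<close>.\<close>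
  then have "eventually (\<lambda>k. (\<integral>x. q k x \<partial>M) < e / 4 \<and> 1 \<le> k) sequentially"
    using eventually_ge_at_top by (rule eventually_conj)
  then obtain k where k: "(\<integral>x. q k x \<partial>M) < e / 4" "1 \<le> k"
    using eventually_happens'[OF sequentially_bot] by blast
  define A where "A n = {x \<in> space M. 1 / real k \<le> \<bar>g n x - f x\<bar>}" for n
  have A_sets [measurable]: "A n \<in> sets M" for n
    unfolding A_def by measurable
  have A_lim: "(\<lambda>n. emeasure M (A n)) \<longlonglongrightarrow> 0"
    using lim k(2) unfolding tendsto_in_measure_def A_def by auto
  \<comment> \<open>The real-valued \<open>measure\<close> reads an infinite measure as 0, so its
    limit alone does not make the indicator of \<open>A n\<close> integrable.\<close>
  have A_fin: "eventually (\<lambda>n. emeasure M (A n) < \<infinity>) sequentially"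
    by (rule order_tendstoD(2)[OF A_lim]) simp
  have "(\<lambda>n. measure M (A n)) \<longlonglongrightarrow> 0"
    unfolding measure_def using tendsto_enn2real[of _ 0] A_lim by simp
  then have "(\<lambda>n. real k * measure M (A n)) \<longlonglongrightarrow> 0"
    by (rule tendsto_mult_right_zero)
  then have "eventually (\<lambda>n. real k * measure M (A n) < e / 4) sequentially"
    using e by (intro order_tendstoD(2)[of _ 0]) auto
  with A_fin have "eventually (\<lambda>n. (\<integral>x. \<bar>g n x - f x\<bar> \<partial>M) < e) sequentially"
  proof eventually_elim
    case (elim n)
    have ind: "integrable M (\<lambda>x. real k * indicator (A n) x :: real)"
      using elim(1) by (intro integrable_mult_right integrable_real_indicator A_sets)
    have pos: "integrable M (\<lambda>x. max 0 (f x - g n x))"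
      using f(1) g(1) by auto
    \<comment> \<open>With u = f - g n, the identity |u| = 2 max(0, u) - u is integrated; the
      integral of u vanishes by \<open>eq\<close>. The factor 2 is why both error terms were taken
      below \<open>e / 4\<close>.\<close>
    have "(\<integral>x. \<bar>g n x - f x\<bar> \<partial>M) = (\<integral>x. 2 * max 0 (f x - g n x) - (f x - g n x) \<partial>M)"
      by (intro Bochner_Integration.integral_cong) (auto simp: max_def)
    also have "\<dots> = 2 * (\<integral>x. max 0 (f x - g n x) \<partial>M)"
      using f(1) g(1) pos by (simp add: eq)
    also have "(\<integral>x. max 0 (f x - g n x) \<partial>M) \<le> (\<integral>x. q k x + real k * indicator (A n) x \<partial>M)"
    proof (intro integral_mono pos Bochner_Integration.integrable_add q_int ind)
      fix x assume x: "x \<in> space M"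
      show "max 0 (f x - g n x) \<le> q k x + real k * indicator (A n) x"
      proof (cases "x \<in> A n")
        case True
        have "0 \<le> min (f x) (1 / real k)"
          using f(2) by simp
        moreover have "max 0 (f x - g n x) \<le> max 0 (f x - real k) + real k"
          using g(2)[of n x] by (simp add: max_def)
        ultimately show ?thesis
          using True unfolding q_def by (simp only: indicator_simps)
      next
        case False
        then have "max 0 (f x - g n x) \<le> min (f x) (1 / real k)"
          using x f(2)[of x] g(2)[of n x] by (auto simp: A_def)
        then show ?thesis
          using False by (simp add: q_def add_increasing2)
      qed
    qed
    also have "\<dots> = (\<integral>x. q k x \<partial>M) + real k * measure M (A n)"
      using q_int ind by (subst Bochner_Integration.integral_add) auto
    finally show ?case
      using k(1) elim(2) by simp
  qed
  then show "\<exists>N. \<forall>n\<ge>N. norm ((\<integral>x. \<bar>g n x - f x\<bar> \<partial>M) - 0) < e"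
    by (simp add: eventually_sequentially)
qed

section \<open>Pointwise estimates for the truncated logarithm\<close>

definition clip :: "real \<Rightarrow> real \<Rightarrow> real" where
  "clip M y = max (- M) (min M y)"

lemma clip_measurable [measurable]: "clip M \<in> borel_measurable borel"
  unfolding clip_def by measurable

lemma abs_clip_le: "0 \<le> M \<Longrightarrow> \<bar>clip M y\<bar> \<le> M"
  by (auto simp: clip_def)

lemma abs_clip_le_abs: "0 \<le> M \<Longrightarrow> \<bar>clip M y\<bar> \<le> \<bar>y\<bar>"
  by (auto simp: clip_def)

lemma abs_clip_diff_le: "\<bar>clip M y - clip M z\<bar> \<le> \<bar>y - z\<bar>"
  by (auto simp: clip_def)

lemma clip_eq: "\<bar>y\<bar> \<le> M \<Longrightarrow> clip M y = y"
  by (auto simp: clip_def)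

text \<open>For 0 < s <= t the difference splits as in the product rule. The factor
  \<open>t - s\<close> meets a clipped value of size at most \<open>M\<close>. The other term
  carries the smaller weight \<open>s\<close>: clipping is 1-Lipschitz, and ln u <= u - 1 at u = t /
  s gives s (ln t - ln s) <= t - s, which contributes the 1 in \<open>M + 1\<close>. At
  \<open>s = 0\<close> the product vanishes whatever value \<open>ln 0\<close> has.\<close>

lemma lipschitz_mult_clip_ln:
  assumes M: "0 \<le> M" and "0 \<le> s" "0 \<le> t"
  shows "\<bar>t * clip M (ln t) - s * clip M (ln s)\<bar> \<le> (M + 1) * \<bar>t - s\<bar>"
  using assms(2,3)
proof (induction s t rule: linorder_wlog)
  case (le s t)
  show ?case
  proof (cases "s = 0")
    case True
    have "t * \<bar>clip M (ln t)\<bar> \<le> t * (M + 1)"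
      using le abs_clip_le[OF M, of "ln t"] by (intro mult_left_mono) auto
    then show ?thesis
      using True le by (simp add: abs_mult mult.commute)
  next
    case False
    then have s: "0 < s" and t: "0 < t"
      using le by auto
    have "ln t - ln s \<le> t / s - 1"
      using ln_le_minus_one[of "t / s"] s t by (simp add: ln_div)
    then have "s * (ln t - ln s) \<le> t - s"
      using mult_left_mono[of _ "t / s - 1" s] s by (fastforce simp: right_diff_distrib)
    moreover have "\<bar>ln t - ln s\<bar> = ln t - ln s"
      using le s t by simp
    then have "s * \<bar>clip M (ln t) - clip M (ln s)\<bar> \<le> s * (ln t - ln s)"
      using s abs_clip_diff_le[of M "ln t" "ln s"] by (intro mult_left_mono) auto
    moreover have "(t - s) * \<bar>clip M (ln t)\<bar> \<le> (t - s) * M"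
      using le abs_clip_le[OF M] by (intro mult_left_mono) auto
    moreover have "t * clip M (ln t) - s * clip M (ln s)
        = (t - s) * clip M (ln t) + s * (clip M (ln t) - clip M (ln s))"
      by (simp add: algebra_simps)
    then have "\<bar>t * clip M (ln t) - s * clip M (ln s)\<bar>
        \<le> (t - s) * \<bar>clip M (ln t)\<bar> + s * \<bar>clip M (ln t) - clip M (ln s)\<bar>"
      using le s abs_triangle_ineq[of "(t - s) * clip M (ln t)" "s * (clip M (ln t) - clip M (ln s))"]
      by (simp add: abs_mult)
    moreover have "(M + 1) * \<bar>t - s\<bar> = (t - s) * M + (t - s)"
      using le by (simp add: algebra_simps)
    ultimately show ?thesis
      by linarith
  qed
next
  case (sym s t)
  then show ?case
    by (simp add: abs_minus_commute)
qed

text \<open>The error vanishes unless |y| > M. There it is at most |y|, and trading the power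
  \<open>1 - \<alpha>\<close> of |y| for that of \<open>M\<close> only increases the bound, since
  the exponent is not positive.\<close>

lemma abs_diff_clip_le:
  assumes M: "0 < M" and \<alpha>: "1 \<le> \<alpha>"
  shows "\<bar>y - clip M y\<bar> \<le> M powr (1 - \<alpha>) * \<bar>y\<bar> powr \<alpha>"
proof (cases "\<bar>y\<bar> \<le> M")
  case True
  then show ?thesis
    by (simp add: clip_eq)
next
  case False
  then have y: "M < \<bar>y\<bar>"
    by simp
  have "\<bar>y - clip M y\<bar> \<le> \<bar>y\<bar>"
    using M by (auto simp: clip_def)
  also have "\<dots> = \<bar>y\<bar> powr (1 - \<alpha>) * \<bar>y\<bar> powr \<alpha>"
    using y M by (simp flip: powr_add)
  also have "\<dots> \<le> M powr (1 - \<alpha>) * \<bar>y\<bar> powr \<alpha>"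
    using y M \<alpha> by (intro mult_right_mono powr_mono2') auto
  finally show ?thesis .
qed

section \<open>Integrals with the truncated logarithm\<close>

lemma is_pdf_integrable:
  assumes "is_pdf f"
  shows "integrable lebesgue f" "(\<integral>x. f x \<partial>lebesgue) = 1"
proof -
  have "has_bochner_integral lebesgue f 1"
    using assms unfolding is_pdf_def by (intro has_bochner_integral_nn_integral) auto
  then show "integrable lebesgue f" "(\<integral>x. f x \<partial>lebesgue) = 1"
    by (auto simp: has_bochner_integral_iff)
qed

lemma integrable_mult_clip:
  fixes g h :: "'a \<Rightarrow> real"
  assumes "0 \<le> M" and g: "integrable N g" and [measurable]: "h \<in> borel_measurable N"
  shows "integrable N (\<lambda>x. g x * clip M (h x))"
proof (rule Bochner_Integration.integrable_bound[where f = "\<lambda>x. M * g x"])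
  have [measurable]: "g \<in> borel_measurable N"
    using g by auto
  show "(\<lambda>x. g x * clip M (h x)) \<in> borel_measurable N"
    by measurable
  show "AE x in N. norm (g x * clip M (h x)) \<le> norm (M * g x)"
    using assms(1) abs_clip_le[OF assms(1)]
    by (auto simp: abs_mult mult.commute[of M] intro!: AE_I2 mult_left_mono)
qed (use g in auto)

text \<open>Intended for the limit density, which comes with finite entropy but no moment bound:
  dominated convergence removes the truncation, without a rate.\<close>

lemma tendsto_integral_mult_clip:
  fixes g h :: "'a \<Rightarrow> real"
  assumes gh: "integrable N (\<lambda>x. g x * h x)"
    and [measurable]: "g \<in> borel_measurable N" "h \<in> borel_measurable N"
  shows "(\<lambda>k. \<integral>x. g x * clip (real k) (h x) \<partial>N) \<longlonglongrightarrow> (\<integral>x. g x * h x \<partial>N)"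
proof (rule integral_dominated_convergence[where w = "\<lambda>x. \<bar>g x * h x\<bar>"])
  have "(\<lambda>k. g x * clip (real k) (h x)) \<longlonglongrightarrow> g x * h x" for x
  proof (rule tendsto_eventually)
    have "eventually (\<lambda>k. \<bar>h x\<bar> \<le> real k) sequentially"
      using filterlim_real_sequentially unfolding filterlim_at_top by blast
    then show "eventually (\<lambda>k. g x * clip (real k) (h x) = g x * h x) sequentially"
      by eventually_elim (simp add: clip_eq)
  qed
  then show "AE x in N. (\<lambda>k. g x * clip (real k) (h x)) \<longlonglongrightarrow> g x * h x"
    by simp
  show "AE x in N. norm (g x * clip (real k) (h x)) \<le> \<bar>g x * h x\<bar>" for k
    by (auto simp: abs_mult intro!: AE_I2 mult_left_mono abs_clip_le_abs)
qed (use gh in auto)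

text \<open>The pointwise clipping error is integrated against the density. The bound depends on
  \<open>f\<close> only through \<open>C\<close>, hence is uniform over a family with a common
  moment bound.\<close>

lemma entropy_truncation_error:
  assumes f: "is_pdf f" and \<alpha>: "1 \<le> \<alpha>" and M: "0 < M" and C: "0 \<le> C"
    and moment: "(\<integral>\<^sup>+x. ennreal (f x * \<bar>ln (f x)\<bar> powr \<alpha>) \<partial>lebesgue) \<le> ennreal C"
  shows "\<bar>(\<integral>x. f x * ln (f x) \<partial>lebesgue) - (\<integral>x. f x * clip M (ln (f x)) \<partial>lebesgue)\<bar>
    \<le> M powr (1 - \<alpha>) * C"
proof -
  note f_int = is_pdf_integrable[OF f]
  have [measurable]: "f \<in> borel_measurable lebesgue" and f0: "0 \<le> f x" for x
    using f by (auto simp: is_pdf_def)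
  have mom_int: "integrable lebesgue (\<lambda>x. f x * \<bar>ln (f x)\<bar> powr \<alpha>)"
    using moment f0 by (intro integrableI_nonneg) (auto simp: le_less_trans)
  have mom_le: "(\<integral>x. f x * \<bar>ln (f x)\<bar> powr \<alpha> \<partial>lebesgue) \<le> C"
    using moment C f0 by (subst (asm) nn_integral_eq_integral[OF mom_int]) auto
  have clip_int: "integrable lebesgue (\<lambda>x. f x * clip M (ln (f x)))"
    using M f_int by (intro integrable_mult_clip) auto
  have err: "\<bar>f x * ln (f x) - f x * clip M (ln (f x))\<bar>
      \<le> M powr (1 - \<alpha>) * (f x * \<bar>ln (f x)\<bar> powr \<alpha>)" for x
    using mult_left_mono[OF abs_diff_clip_le[OF M \<alpha>, of "ln (f x)"] f0[of x]] f0[of x]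
    by (simp add: abs_mult ac_simps flip: right_diff_distrib)
  have bound_int: "integrable lebesgue (\<lambda>x. M powr (1 - \<alpha>) * (f x * \<bar>ln (f x)\<bar> powr \<alpha>))"
    using mom_int by simp
  have err_int: "integrable lebesgue (\<lambda>x. f x * ln (f x) - f x * clip M (ln (f x)))"
    by (rule Bochner_Integration.integrable_bound[OF bound_int])
       (auto intro!: AE_I2 order_trans[OF err])
  \<comment> \<open>Finiteness of the entropy is a consequence of the moment bound here: the
    clipping error and the clipped integrand are both integrable. Otherwise the integral could be
    the default value 0.\<close>
  have "integrable lebesgue (\<lambda>x. f x * ln (f x))"
    using Bochner_Integration.integrable_add[OF err_int clip_int] by simp
  then have "\<bar>(\<integral>x. f x * ln (f x) \<partial>lebesgue) - (\<integral>x. f x * clip M (ln (f x)) \<partial>lebesgue)\<bar>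
      = \<bar>\<integral>x. f x * ln (f x) - f x * clip M (ln (f x)) \<partial>lebesgue\<bar>"
    using clip_int by simp
  also have "\<dots> \<le> (\<integral>x. M powr (1 - \<alpha>) * (f x * \<bar>ln (f x)\<bar> powr \<alpha>) \<partial>lebesgue)"
    using err by (intro integral_abs_bound_integral err_int bound_int)
  also have "\<dots> \<le> M powr (1 - \<alpha>) * C"
    using mom_le by (simp add: mult_left_mono)
  finally show ?thesis .
qed

text \<open>At a fixed level \<open>M\<close>, the Lipschitz estimate bounds the difference of the
  integrals by \<open>M + 1\<close> times the L1 distance.\<close>

lemma tendsto_integral_mult_clip_ln:
  fixes g :: "nat \<Rightarrow> 'a \<Rightarrow> real" and f :: "'a \<Rightarrow> real"
  assumes M: "0 \<le> M"
    and g: "\<And>n. integrable N (g n)" "\<And>n x. 0 \<le> g n x"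
    and f: "integrable N f" "\<And>x. 0 \<le> f x"
    and L1: "(\<lambda>n. \<integral>x. \<bar>g n x - f x\<bar> \<partial>N) \<longlonglongrightarrow> 0"
  shows "(\<lambda>n. \<integral>x. g n x * clip M (ln (g n x)) \<partial>N) \<longlonglongrightarrow> (\<integral>x. f x * clip M (ln (f x)) \<partial>N)"
proof (rule Lim_transform_bound[OF _ tendsto_mult_right_zero[OF L1, of "M + 1"], THEN LIM_zero_cancel])
  have [measurable]: "f \<in> borel_measurable N" "g n \<in> borel_measurable N" for n
    using f g by auto
  have int: "integrable N (\<lambda>x. f x * clip M (ln (f x)))"
      "integrable N (\<lambda>x. g n x * clip M (ln (g n x)))" for n
    using M f g by (auto intro!: integrable_mult_clip)
  show "\<forall>\<^sub>F n in sequentially.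
      norm ((\<integral>x. g n x * clip M (ln (g n x)) \<partial>N) - (\<integral>x. f x * clip M (ln (f x)) \<partial>N))
      \<le> norm ((M + 1) * (\<integral>x. \<bar>g n x - f x\<bar> \<partial>N))"
  proof (intro always_eventually allI)
    fix n
    let ?d = "\<lambda>x. g n x * clip M (ln (g n x)) - f x * clip M (ln (f x))"
    have "\<bar>\<integral>x. ?d x \<partial>N\<bar> \<le> (\<integral>x. \<bar>?d x\<bar> \<partial>N)"
      by (rule integral_abs_bound)
    also have "\<dots> \<le> (\<integral>x. (M + 1) * \<bar>g n x - f x\<bar> \<partial>N)"
      by (intro integral_mono lipschitz_mult_clip_ln M f g integrable_abs integrable_mult_right
          Bochner_Integration.integrable_diff int)
    finally have "\<bar>\<integral>x. ?d x \<partial>N\<bar> \<le> (\<integral>x. (M + 1) * \<bar>g n x - f x\<bar> \<partial>N)" .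
    then show "norm ((\<integral>x. g n x * clip M (ln (g n x)) \<partial>N) - (\<integral>x. f x * clip M (ln (f x)) \<partial>N))
        \<le> norm ((M + 1) * (\<integral>x. \<bar>g n x - f x\<bar> \<partial>N))"
      using int by simp
  qed
qed

section \<open>Convergence of the entropies\<close>

theorem corollary10:
  fixes F :: "nat \<Rightarrow> real ^ 'd \<Rightarrow> real" and f :: "real ^ 'd \<Rightarrow> real" and \<alpha> :: real
  assumes "\<And>n. n \<ge> 1 \<Longrightarrow> is_pdf (F n)"
    and "is_pdf f"
    and "tendsto_in_measure lebesgue F f"
    and "finite_diff_entropy f"
    and "\<alpha> > 1"
    and "(SUP n\<in>{1..}. \<integral>\<^sup>+x. ennreal (F n x * \<bar>ln (F n x)\<bar> powr \<alpha>) \<partial>lebesgue) < \<infinity>"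
  shows "(\<lambda>n. diff_entropy (F n)) \<longlonglongrightarrow> diff_entropy f"
proof -
  \<comment> \<open>Nothing makes \<open>F 0\<close> a density, so the argument runs on the shifted
    sequence; \<open>LIMSEQ_imp_Suc\<close> undoes the shift at the end.\<close>
  define G where "G n = F (Suc n)" for n
  have G_pdf: "is_pdf (G n)" for n
    using assms(1) by (simp add: G_def)
  obtain C where C: "0 \<le> C"
    and SUP: "(SUP n\<in>{1..}. \<integral>\<^sup>+x. ennreal (F n x * \<bar>ln (F n x)\<bar> powr \<alpha>) \<partial>lebesgue) = ennreal C"
    using assms(6) by (auto simp: less_top_ennreal)
  have moment: "(\<integral>\<^sup>+x. ennreal (G n x * \<bar>ln (G n x)\<bar> powr \<alpha>) \<partial>lebesgue) \<le> ennreal C" for n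
    unfolding G_def SUP[symmetric] by (rule SUP_upper) simp
  note G_int = is_pdf_integrable[OF G_pdf] and f_int = is_pdf_integrable[OF assms(2)]
  have G0: "0 \<le> G n x" and f0: "0 \<le> f x" for n x
    using G_pdf assms(2) by (auto simp: is_pdf_def)
  have [measurable]: "f \<in> borel_measurable lebesgue"
    using f_int by auto
  have "tendsto_in_measure lebesgue G f"
    using assms(3) unfolding tendsto_in_measure_def G_def by (auto intro: LIMSEQ_Suc)
  then have L1: "(\<lambda>n. \<integral>x. \<bar>G n x - f x\<bar> \<partial>lebesgue) \<longlonglongrightarrow> 0"
    by (intro tendsto_in_measure_imp_L1 G_int f_int G0 f0) (simp_all add: G_int f_int)
  define h where "h g = (\<integral>x. g x * ln (g x) \<partial>lebesgue)" for g :: "real ^ 'd \<Rightarrow> real"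
  define t where "t M g = (\<integral>x. g x * clip M (ln (g x)) \<partial>lebesgue)" for M and g :: "real ^ 'd \<Rightarrow> real"
  have "(\<lambda>n. h (G n)) \<longlonglongrightarrow> h f"
  proof (rule LIMSEQ_I)
    fix e :: real assume e: "0 < e"
    \<comment> \<open>The level \<open>k\<close> is chosen first, so that truncation costs less than
      \<open>e / 3\<close> for \<open>f\<close> and, uniformly in \<open>n\<close>, for every
      \<open>G n\<close>; only then is \<open>n\<close> taken large enough to bring the truncated
      integrals within \<open>e / 3\<close>. Here \<open>\<alpha> > 1\<close> makes the exponent
      negative.\<close>
    have "(\<lambda>k. real k powr (1 - \<alpha>)) \<longlonglongrightarrow> 0"
      using assms(5) by (intro tendsto_neg_powr filterlim_real_sequentially) simp
    then have "(\<lambda>k. real k powr (1 - \<alpha>) * C) \<longlonglongrightarrow> 0"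
      by (rule tendsto_mult_left_zero)
    then have "\<forall>\<^sub>F k in sequentially. real k powr (1 - \<alpha>) * C < e / 3"
      using e by (intro order_tendstoD(2)[of _ 0]) auto
    moreover have "(\<lambda>k. t (real k) f) \<longlonglongrightarrow> h f"
      using assms(4) unfolding t_def h_def finite_diff_entropy_def
      by (intro tendsto_integral_mult_clip) auto
    then have "\<forall>\<^sub>F k in sequentially. dist (t (real k) f) (h f) < e / 3"
      using e by (intro tendstoD) auto
    ultimately have "\<forall>\<^sub>F k in sequentially.
        real k powr (1 - \<alpha>) * C < e / 3 \<and> dist (t (real k) f) (h f) < e / 3 \<and> 0 < k"
      using eventually_gt_at_top[of "0::nat"] by eventually_elim simp
    then obtain k where k: "real k powr (1 - \<alpha>) * C < e / 3" "dist (t (real k) f) (h f) < e / 3" "0 < k"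
      using eventually_happens'[OF sequentially_bot] by blast
    have "(\<lambda>n. t (real k) (G n)) \<longlonglongrightarrow> t (real k) f"
      unfolding t_def by (intro tendsto_integral_mult_clip_ln G_int f_int G0 f0 L1) simp
    then have "\<forall>\<^sub>F n in sequentially. dist (t (real k) (G n)) (t (real k) f) < e / 3"
      using e by (intro tendstoD) auto
    then have "\<forall>\<^sub>F n in sequentially. norm (h (G n) - h f) < e"
    proof eventually_elim
      case (elim n)
      have "\<bar>h (G n) - t (real k) (G n)\<bar> \<le> real k powr (1 - \<alpha>) * C"
        unfolding h_def t_def using assms(5) k(3) C
        by (intro entropy_truncation_error G_pdf moment) auto
      with elim k(1,2) show ?case
        unfolding dist_real_def real_norm_def by linarith
    qed
    then show "\<exists>N. \<forall>n\<ge>N. norm (h (G n) - h f) < e"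
      by (simp add: eventually_sequentially)
  qed
  then have "(\<lambda>n. diff_entropy (F (Suc n))) \<longlonglongrightarrow> diff_entropy f"
    unfolding diff_entropy_def h_def G_def by (rule tendsto_minus)
  then show ?thesis
    by (rule LIMSEQ_imp_Suc)
qed

end
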